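(* Let $X$ and $Y$ be vector lattices, and let $T\colon X\to Y$ be a map satisfying $$|T(x)-T(y)|=T(|x-y|)\qquad\text{for all } x,y\in X.$$ Then $T$ is a $\mathbb{Q}$-linear map that preserves all lattice operations. Furthermore, if $Y$ is also Archimedean, then $T$ is a lattice homomorphism.
   Context: All vector spaces are real and nontrivial. Maps are not assumed linear or affine unless stated; "linear" means $\mathbb{R}$-linear. A *vector lattice* is a vector space with a partial order compatible with the linear structure ($x\le y$ implies $x+z\le y+z$ and $ax\le ay$ for real $a\ge 0$) in which every pair $x,y$ has a supremum $x\vee y$ and an infimum $x\wedge y$. Put $|x|:=x\vee(-x)$, $x^+:=x\vee 0$, $x^-:=(-x)\vee 0$. The five lattice operations are $|x|$, $x\wedge y$, $x\vee y$, $x^+$, $x^-$. A map *preserves all lattice operations* if it commutes with each of these five operations. A *lattice homomorphism* is a linear map preserving all lattice operations. A vector lattice $Y$ is *Archimedean* if for every $y\in Y$ with $y\ge 0$ one has $\inf_{n\in\mathbb{N}}\frac1n y=0$. A map $T\colon X\to Y$ between vector spaces is *$\mathbb{Q}$-linear* if $T(px+qy)=pT(x)+qT(y)$ for all $p,q\in\mathbb{Q}$ and $x,y\in X$. *)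

theory Defs
  imports Complex_Main "HOL-Library.Lattice_Algebras" "HOL-Library.Lub_Glb"
begin

text \<open>
  The class \<^class>\<open>lattice_ab_group_add_abs\<close> fixes \<open>\<bar>x\<bar> = sup x (- x)\<close>. In \<^class>\<open>ordered_real_vector\<close>
  monotonicity of scaling in the scalar follows from the other axioms, so it adds nothing to the
  usual definition of a vector lattice. Vector spaces are assumed nontrivial throughout.
\<close>

class vector_lattice = ordered_real_vector + lattice_ab_group_add_abs +
  assumes nontrivial: "\<exists>x. x \<noteq> 0"

instance real :: vector_lattice
  by standard (rule exI[of _ 1], simp)

text \<open>
  The positive and negative parts are \<open>x\<^sup>+ = sup x 0\<close> and \<open>x\<^sup>- = sup (- x) 0\<close>; the latter is
  \<open>- nprt x\<close> for the library's \<^const>\<open>nprt\<close>.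
\<close>

definition preserves_lattice_operations :: "('a::vector_lattice \<Rightarrow> 'b::vector_lattice) \<Rightarrow> bool"
  where "preserves_lattice_operations T \<longleftrightarrow>
    (\<forall>x. T \<bar>x\<bar> = \<bar>T x\<bar>) \<and>
    (\<forall>x y. T (inf x y) = inf (T x) (T y)) \<and>
    (\<forall>x y. T (sup x y) = sup (T x) (T y)) \<and>
    (\<forall>x. T (sup x 0) = sup (T x) 0) \<and>
    (\<forall>x. T (sup (- x) 0) = sup (- T x) 0)"

definition lattice_homomorphism :: "('a::vector_lattice \<Rightarrow> 'b::vector_lattice) \<Rightarrow> bool"
  where "lattice_homomorphism T \<longleftrightarrow> linear T \<and> preserves_lattice_operations T"

definition archimedean_lattice :: "'a::vector_lattice itself \<Rightarrow> bool"
  where "archimedean_lattice _ \<longleftrightarrow>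
    (\<forall>y::'a. 0 \<le> y \<longrightarrow> isGlb UNIV {(1 / real n) *\<^sub>R y | n. 0 < n} 0)"

definition rat_linear :: "('a::real_vector \<Rightarrow> 'b::real_vector) \<Rightarrow> bool"
  where "rat_linear T \<longleftrightarrow>
    (\<forall>p\<in>\<rat>. \<forall>q\<in>\<rat>. \<forall>x y. T (p *\<^sub>R x + q *\<^sub>R y) = p *\<^sub>R T x + q *\<^sub>R T y)"

end

theory Submission
  imports Defs
begin

text \<open>
  On the positive cone the hypothesis only determines differences up to absolute value. For doubling,
  comparing the values at \<open>x/2\<close>, \<open>x\<close>, \<open>3x/2\<close> and \<open>2x\<close> gives \<open>T x \<le> T (2x)\<close>, which forces
  \<open>T (2x) = 2 T x\<close>. For sums put \<open>p = T u\<close>, \<open>q = T v\<close>, \<open>s = T (u + v)\<close>, \<open>t = T (2u + v)\<close>. Then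
  \<open>\<bar>t - s\<bar> = p\<close> and \<open>\<bar>s - p\<bar> = q\<close>, whence \<open>2p = T (2u) = \<bar>t - q\<bar> \<le> 2s\<close>, so that
  \<open>q = \<bar>s - p\<bar> = s - p\<close>. Additivity extends to the whole space through \<open>T (u - v) = T u - T v\<close> for
  positive \<open>u\<close>, \<open>v\<close>. In the Archimedean case, approximating a real \<open>r\<close> by rationals bounds
  \<open>\<bar>T (r x) - r T x\<bar>\<close> by \<open>2 T \<bar>x\<bar> / n\<close> for every \<open>n\<close>.
\<close>

lemma lattice_abs_le_iff:
  fixes a b :: "'a::vector_lattice"
  shows "\<bar>a\<bar> \<le> b \<longleftrightarrow> a \<le> b \<and> - a \<le> b"
  by (simp add: abs_lattice)

lemma scaleR_two_le_iff:
  fixes a b :: "'a::ordered_real_vector"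
  shows "a + a \<le> b + b \<longleftrightarrow> a \<le> b"
  using scaleR_le_cancel_left_pos[of 2 a b] by (simp add: scaleR_2)

lemma abs_scaleR_le:
  fixes a :: "'a::vector_lattice"
  assumes "0 \<le> c"
  shows "\<bar>c *\<^sub>R a\<bar> \<le> c *\<^sub>R \<bar>a\<bar>"
  using scaleR_left_mono[OF abs_ge_self assms, of a]
    scaleR_left_mono[OF abs_ge_minus_self assms, of a]
  by (simp add: lattice_abs_le_iff)

text \<open>Translating \<open>\<bar>a - b\<bar>\<close> by \<open>a + b\<close> turns it into the
  supremum of \<open>2a\<close> and \<open>2b\<close>. Suprema are thereby carried over by any
  rational-linear map that commutes with absolute values.\<close>

lemma sup_eq_half_abs:
  fixes a b :: "'a::vector_lattice"
  shows "sup a b = (1/2) *\<^sub>R (a + b + \<bar>a - b\<bar>)"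
proof -
  have "a + b + \<bar>a - b\<bar> = sup (a + b + (a - b)) (a + b + (b - a))"
    by (simp add: abs_lattice add_sup_distrib_left)
  also have "\<dots> = sup (2 *\<^sub>R a) (2 *\<^sub>R b)"
    by (simp add: scaleR_2 algebra_simps)
  also have "\<dots> = 2 *\<^sub>R sup a b"
  proof (rule antisym)
    show "sup (2 *\<^sub>R a) (2 *\<^sub>R b) \<le> 2 *\<^sub>R sup a b"
      by (simp add: scaleR_left_mono)
    have "a \<le> (1/2) *\<^sub>R sup (2 *\<^sub>R a) (2 *\<^sub>R b)" "b \<le> (1/2) *\<^sub>R sup (2 *\<^sub>R a) (2 *\<^sub>R b)"
      using scaleR_left_mono[of "2 *\<^sub>R a" "sup (2 *\<^sub>R a) (2 *\<^sub>R b)" "1/2"]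
        scaleR_left_mono[of "2 *\<^sub>R b" "sup (2 *\<^sub>R a) (2 *\<^sub>R b)" "1/2"] by simp_all
    then have "sup a b \<le> (1/2) *\<^sub>R sup (2 *\<^sub>R a) (2 *\<^sub>R b)" by simp
    then show "2 *\<^sub>R sup a b \<le> sup (2 *\<^sub>R a) (2 *\<^sub>R b)"
      using scaleR_left_mono[of "sup a b" "(1/2) *\<^sub>R sup (2 *\<^sub>R a) (2 *\<^sub>R b)" 2] by simp
  qed
  finally show ?thesis by simp
qed

text \<open>Multiplying by the denominator reduces rational scalars to integers.\<close>

lemma additive_imp_rat_linear:
  assumes "additive T"
  shows "rat_linear T"
proof -
  interpret additive T by fact
  have nat: "T (real n *\<^sub>R x) = real n *\<^sub>R T x" for n x
    by (induction n) (simp_all add: zero add scaleR_add_left)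
  have int: "T (of_int k *\<^sub>R x) = of_int k *\<^sub>R T x" for k x
    by (cases k rule: int_cases2) (simp_all add: nat minus)
  have "T (p *\<^sub>R x) = p *\<^sub>R T x" if "p \<in> \<rat>" for p x
  proof -
    obtain a b where p: "p = of_int a / of_int b" "b > 0"
      using \<open>p \<in> \<rat>\<close> by (rule Rats_cases')
    have "of_int b *\<^sub>R T (p *\<^sub>R x) = T (of_int b *\<^sub>R p *\<^sub>R x)"
      by (simp only: int)
    also have "\<dots> = of_int a *\<^sub>R T x"
      using p by (simp add: int)
    also have "\<dots> = of_int b *\<^sub>R p *\<^sub>R T x"
      using p by simp
    finally show ?thesis
      using p by (simp only: scaleR_cancel_left) simp
  qed
  then show ?thesis
    by (simp add: rat_linear_def add)
qed

locale abs_diff_preserving =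
  fixes T :: "'a::vector_lattice \<Rightarrow> 'b::vector_lattice"
  assumes abs_diff: "\<bar>T x - T y\<bar> = T \<bar>x - y\<bar>"
begin

lemma zero: "T 0 = 0"
proof -
  have "T \<bar>0 - 0\<bar> = \<bar>T 0 - T 0\<bar>"
    by (simp only: abs_diff)
  then show ?thesis by simp
qed

lemma abs: "T \<bar>x\<bar> = \<bar>T x\<bar>"
  using abs_diff[of x 0] by (simp add: zero)

lemma nonneg: "0 \<le> T x" if "0 \<le> x"
  using abs[of x] that by (metis abs_of_nonneg abs_ge_zero)

lemma abs_diff_add: "\<bar>T (u + v) - T u\<bar> = T v" if "0 \<le> v"
  using abs_diff[of "u + v" u] that by simp

lemma double: "T (x + x) = T x + T x" if x: "0 \<le> x"
proof -
  define h where "h = (1/2) *\<^sub>R x"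
  have h: "h + h = x" "0 \<le> h"
    using x by (simp_all add: h_def scaleR_nonneg_nonneg flip: scaleR_add_left)
  let ?e = "T h" and ?a = "T x" and ?f = "T (x + h)" and ?b = "T (x + x)"
  have "?a = \<bar>?f - ?e\<bar>"
    using abs_diff_add[OF x, of h] by (simp add: add.commute)
  \<comment> \<open>The elements \<open>x + x\<close> and \<open>h\<close> differ by
    \<open>x + h\<close>, which gives a second expression for \<open>?f\<close>.\<close>
  also have "?f = \<bar>?b - ?e\<bar>"
    using abs_diff_add[of "x + h" h] abs_diff[of "x + x" h] h x
    by (smt (verit) abs_of_nonneg add.assoc add.commute add_diff_cancel_left' add_nonneg_nonneg)
  \<comment> \<open>Since \<open>?e\<close> is positive it equals \<open>\<bar>?e\<bar>\<close>, and
    the reverse triangle inequality then removes \<open>?e\<close> altogether.\<close>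
  also have "\<bar>\<bar>?b - ?e\<bar> - ?e\<bar> = \<bar>\<bar>?b - ?e\<bar> - \<bar>?e\<bar>\<bar>"
    using nonneg[OF h(2)] by simp
  also have "\<dots> \<le> \<bar>?b\<bar>"
    using abs_triangle_ineq3[of "?b - ?e" "- ?e"] by simp
  also have "\<dots> = ?b"
    using nonneg x by simp
  finally have "?a \<le> ?b" .
  then show ?thesis
    using abs_diff_add[OF x, of x] by (simp add: algebra_simps)
qed

lemma add_nonneg: "T (u + v) = T u + T v" if u: "0 \<le> u" and v: "0 \<le> v"
proof -
  define p q s t where "p = T u" and "q = T v" and "s = T (u + v)" and "t = T (u + u + v)"
  have ge0: "0 \<le> p" "0 \<le> q" "0 \<le> s" "0 \<le> t"
    using u v by (simp_all add: p_def q_def s_def t_def nonneg)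
  have p: "\<bar>t - s\<bar> = p"
    using abs_diff_add[OF u, of "u + v"] by (simp add: p_def s_def t_def ac_simps)
  have q: "\<bar>s - p\<bar> = q"
    using abs_diff_add[OF v, of u] by (simp add: p_def q_def s_def)
  have pp: "\<bar>t - q\<bar> = p + p"
    using abs_diff_add[of "u + u" v] u by (simp add: p_def q_def t_def double ac_simps)
  have "t - s \<le> p"
    using p abs_ge_self[of "t - s"] by simp
  moreover have "p - s \<le> q"
    using q abs_ge_minus_self[of "s - p"] by simp
  ultimately have "t - s + (p - s) \<le> p + q"
    by (rule add_mono)
  then have 1: "t - q \<le> s + s"
    by (simp add: algebra_simps)
  \<comment> \<open>The order is only partial, so bounding \<open>\<bar>t - q\<bar>\<close> takes a
    bound for each sign; the one for \<open>q - t\<close> comes from two triangle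
    inequalities.\<close>
  have "q \<le> s + p"
    using q abs_triangle_ineq4[of s p] ge0 by simp
  moreover have "p \<le> t + s"
    using p abs_triangle_ineq4[of t s] ge0 by simp
  ultimately have "q + p \<le> s + p + (t + s)"
    by (rule add_mono)
  then have 2: "q - t \<le> s + s"
    by (simp add: algebra_simps)
  have "p + p \<le> s + s"
    using 1 2 by (simp add: lattice_abs_le_iff flip: pp)
  then have "p \<le> s"
    by (simp add: scaleR_two_le_iff)
  then have "s = p + q"
    using q by (simp add: algebra_simps)
  then show ?thesis
    by (simp add: p_def q_def s_def)
qed

text \<open>From \<open>\<bar>T (- u)\<bar> = T u\<close> follows \<open>T (- u) \<le> T u\<close>,
  which settles the sign of a difference whose absolute value is known to be
  \<open>2 T u\<close>.\<close>

lemma minus_nonneg: "T (- u) = - T u" if u: "0 \<le> u"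
proof -
  have "\<bar>T (- u)\<bar> = T u"
    using abs[of "- u"] u by simp
  then have "T (- u) - T u \<le> 0"
    using abs_ge_self[of "T (- u)"] by simp
  moreover have "\<bar>T (- u) - T u\<bar> = T u + T u"
    using abs_diff[of "- u" u] abs_minus_cancel[of "u + u"] u by (simp add: double)
  ultimately have "T u - T (- u) = T u + T u"
    by simp
  then show ?thesis
    by (simp add: algebra_simps eq_neg_iff_add_eq_0)
qed

text \<open>Comparing \<open>u - v\<close> with \<open>u\<close> gives the lower bound, comparing it
  with \<open>- v\<close> the upper one.\<close>

lemma diff_nonneg: "T (u - v) = T u - T v" if u: "0 \<le> u" and v: "0 \<le> v"
proof (rule antisym)
  have "\<bar>T (u - v) - T u\<bar> = T v"
    using abs_diff[of "u - v" u] v by simp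
  then show "T u - T v \<le> T (u - v)"
    using abs_ge_minus_self[of "T (u - v) - T u"] by (simp add: algebra_simps)
  have "\<bar>T (u - v) + T v\<bar> = T u"
    using abs_diff[of "u - v" "- v"] u by (simp add: minus_nonneg[OF v])
  then show "T (u - v) \<le> T u - T v"
    using abs_ge_self[of "T (u - v) + T v"] by (simp add: algebra_simps)
qed

sublocale additive T
proof
  fix x y :: 'a
  have decomp: "\<exists>u v. z = u - v \<and> 0 \<le> u \<and> 0 \<le> v" for z :: 'a
    by (rule exI[of _ "pprt z"], rule exI[of _ "- nprt z"]) (simp flip: prts)
  obtain u v where x: "x = u - v" "0 \<le> u" "0 \<le> v"
    using decomp[of x] by blast
  obtain u' v' where y: "y = u' - v'" "0 \<le> u'" "0 \<le> v'"
    using decomp[of y] by blast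
  \<comment> \<open>Regrouping exhibits \<open>x + y\<close> as a difference of positive
    elements.\<close>
  have "T (x + y) = T ((u + u') - (v + v'))"
    by (simp add: x y algebra_simps)
  also have "\<dots> = T (u + u') - T (v + v')"
    using x y by (intro diff_nonneg) simp_all
  also have "\<dots> = T x + T y"
    using x y by (simp add: add_nonneg diff_nonneg)
  finally show "T (x + y) = T x + T y" .
qed

lemma rat_linear: "rat_linear T"
  by (rule additive_imp_rat_linear) unfold_locales

lemma scaleR_Rats: "T (q *\<^sub>R x) = q *\<^sub>R T x" if "q \<in> \<rat>"
  using rat_linear that unfolding rat_linear_def
  by (metis Rats_0 add.right_neutral scaleR_zero_left)

lemma preserves_lattice_operations: "preserves_lattice_operations T"
proof -
  have sup: "T (sup x y) = sup (T x) (T y)" for x y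
    using scaleR_Rats[of "1/2"] by (simp add: sup_eq_half_abs add diff abs)
  have inf: "T (inf x y) = inf (T x) (T y)" for x y
    by (simp only: inf_eq_neg_sup minus sup)
  show ?thesis
    unfolding preserves_lattice_operations_def
    by (intro conjI allI) (simp_all only: abs sup inf zero minus)
qed

lemma monotone: "T x \<le> T y" if "x \<le> y"
  using nonneg[of "y - x"] that by (simp add: diff)

lemma scaleR_defect:
  assumes "0 < n"
  shows "\<bar>T (r *\<^sub>R x) - r *\<^sub>R T x\<bar> \<le> (1 / real n) *\<^sub>R (T \<bar>x\<bar> + T \<bar>x\<bar>)"
proof -
  have "r - 1 / real n < r"
    using assms by simp
  then obtain q where q: "q \<in> \<rat>" "r - 1 / real n < q" "q < r"
    using Rats_dense_in_real by blast
  \<comment> \<open>The contribution of \<open>q\<close> cancels by rational linearity, so only the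
    small scalar \<open>d\<close> enters the defect.\<close>
  define d where "d = r - q"
  have d: "0 \<le> d" "d \<le> 1 / real n"
    using q by (simp_all add: d_def)
  have "T (r *\<^sub>R x) - r *\<^sub>R T x = T (d *\<^sub>R x) - d *\<^sub>R T x"
    using q by (simp add: d_def scaleR_diff_left diff scaleR_Rats)
  then have "\<bar>T (r *\<^sub>R x) - r *\<^sub>R T x\<bar> \<le> \<bar>T (d *\<^sub>R x)\<bar> + \<bar>d *\<^sub>R T x\<bar>"
    by (simp add: abs_triangle_ineq4)
  also have "\<dots> \<le> T (d *\<^sub>R \<bar>x\<bar>) + d *\<^sub>R T \<bar>x\<bar>"
    using abs_scaleR_le[OF d(1), of x] abs_scaleR_le[OF d(1), of "T x"]
    by (intro add_mono) (simp_all add: monotone flip: abs)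
  also have "\<dots> \<le> T ((1 / real n) *\<^sub>R \<bar>x\<bar>) + (1 / real n) *\<^sub>R T \<bar>x\<bar>"
    using d by (intro add_mono monotone scaleR_right_mono) (simp_all add: nonneg)
  also have "\<dots> = (1 / real n) *\<^sub>R (T \<bar>x\<bar> + T \<bar>x\<bar>)"
    using scaleR_Rats[of "1 / real n"] by (simp add: scaleR_add_right)
  finally show ?thesis .
qed

lemma linear_if_archimedean:
  assumes "archimedean_lattice TYPE('b)"
  shows "linear T"
proof (rule linearI)
  fix r x
  let ?y = "T \<bar>x\<bar> + T \<bar>x\<bar>" and ?z = "\<bar>T (r *\<^sub>R x) - r *\<^sub>R T x\<bar>"
  have "isGlb UNIV {(1 / real n) *\<^sub>R ?y | n. 0 < n} 0"
    using assms nonneg[of "\<bar>x\<bar>"] by (simp only: archimedean_lattice_def) simp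
  \<comment> \<open>The defect does not depend on \<open>n\<close>, so it is a lower bound of a set
    with infimum \<open>0\<close>.\<close>
  moreover have "isLb UNIV {(1 / real n) *\<^sub>R ?y | n. 0 < n} ?z"
    using scaleR_defect[of _ r x] by (auto simp: isLb_def setge_def)
  ultimately have "?z \<le> 0"
    by (rule isGlb_le_isLb)
  then show "T (r *\<^sub>R x) = r *\<^sub>R T x"
    by simp
qed (rule add)

end

theorem corollary3p10:
  fixes T :: "'a::vector_lattice \<Rightarrow> 'b::vector_lattice"
  assumes "\<And>x y. \<bar>T x - T y\<bar> = T \<bar>x - y\<bar>"
  shows "rat_linear T \<and> preserves_lattice_operations T \<and>
    (archimedean_lattice TYPE('b) \<longrightarrow> lattice_homomorphism T)"
proof -
  interpret abs_diff_preserving T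
    by standard (rule assms)
  show ?thesis
    by (simp add: rat_linear preserves_lattice_operations linear_if_archimedean
        lattice_homomorphism_def)
qed

end
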